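(* For any structure $\mathcal{M}$ in a language $\Sigma_1$ of unary predicates the pair $$\left(\deg^{\forall\text{-}\mathrm{sem}}_{\mathrm{rig}}(\mathcal{M}),\ \deg^{\forall\text{-}\mathrm{synt}}_{\mathrm{rig}}(\mathcal{M})\right)$$ has one of the following possibilities: 1) $(0,0)$, if $\mathcal{M}$ is both semantically and syntactically rigid; 2) $(n,n)$, if $\mathcal{M}$ is finite with $n+1$ elements and it is not semantically rigid, that is, not syntactically rigid; 3) $(0,\infty)$, if $\mathcal{M}$ is infinite, semantically rigid but not syntactically rigid; 4) $(\infty,\infty)$, if $\mathcal{M}$ is infinite and both not semantically rigid and not syntactically rigid.
   Context: The universe of $\mathcal{M}$ is denoted $M$. For $A\subseteq M$, $\mathrm{dcl}(A)$ is the set of $b\in M$ such that $\{b\}$ is definable in $\mathcal{M}$ by a first-order formula with parameters from $A$. The structure $\mathcal{M}$ is semantically $A$-rigid if the only automorphism of $\mathcal{M}$ fixing $A$ pointwise is the identity; it is syntactically $A$-rigid if $M=\mathrm{dcl}(A)$. "Semantically rigid" and "syntactically rigid" mean the case $A=\emptyset$. For $n\in\omega$, $\mathcal{M}$ is $\forall$-semantically (respectively $\forall$-syntactically) $n$-rigid if it is semantically (respectively syntactically) $A$-rigid for every $A\subseteq M$ with $|A|=n$. The degree $\deg^{\forall\text{-}\mathrm{sem}}_{\mathrm{rig}}(\mathcal{M})$ (respectively $\deg^{\forall\text{-}\mathrm{synt}}_{\mathrm{rig}}(\mathcal{M})$) is the least $n\in\omega$ such that $\mathcal{M}$ is $\forall$-semantically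 (respectively $\forall$-syntactically) $n$-rigid, and is $\infty$ if no such $n$ exists. *)

theory Defs
  imports "HOL-Library.Extended_Nat"
begin

section \<open>First-order languages, structures and satisfaction\<close>

text \<open>
  A language is given by sets of function and relation symbols inside ambient symbol types, so that
  either set may be empty. Constants are function symbols of arity 0.
\<close>

record ('f, 'r) language =
  fun_syms :: "'f set"
  rel_syms :: "'r set"
  fun_arity :: "'f \<Rightarrow> nat"
  rel_arity :: "'r \<Rightarrow> nat"

datatype 'f fo_term =
  Var nat
| Fn 'f "'f fo_term list"

datatype ('f, 'r) fo_formula =
  Eq "'f fo_term" "'f fo_term"
| Rel 'r "'f fo_term list"
| Neg "('f, 'r) fo_formula"
| Conj "('f, 'r) fo_formula" "('f, 'r) fo_formula"
| Exists nat "('f, 'r) fo_formula"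

fun term_in :: "('f, 'r) language \<Rightarrow> 'f fo_term \<Rightarrow> bool" where
  "term_in L (Var i) \<longleftrightarrow> True"
| "term_in L (Fn f ts) \<longleftrightarrow>
     f \<in> fun_syms L \<and> length ts = fun_arity L f \<and> (\<forall>t \<in> set ts. term_in L t)"

primrec formula_in :: "('f, 'r) language \<Rightarrow> ('f, 'r) fo_formula \<Rightarrow> bool" where
  "formula_in L (Eq s t) \<longleftrightarrow> term_in L s \<and> term_in L t"
| "formula_in L (Rel R ts) \<longleftrightarrow>
     R \<in> rel_syms L \<and> length ts = rel_arity L R \<and> (\<forall>t \<in> set ts. term_in L t)"
| "formula_in L (Neg \<phi>) \<longleftrightarrow> formula_in L \<phi>"
| "formula_in L (Conj \<phi> \<psi>) \<longleftrightarrow> formula_in L \<phi> \<and> formula_in L \<psi>"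
| "formula_in L (Exists i \<phi>) \<longleftrightarrow> formula_in L \<phi>"

fun term_vars :: "'f fo_term \<Rightarrow> nat set" where
  "term_vars (Var i) = {i}"
| "term_vars (Fn f ts) = (\<Union>t \<in> set ts. term_vars t)"

primrec free_vars :: "('f, 'r) fo_formula \<Rightarrow> nat set" where
  "free_vars (Eq s t) = term_vars s \<union> term_vars t"
| "free_vars (Rel R ts) = (\<Union>t \<in> set ts. term_vars t)"
| "free_vars (Neg \<phi>) = free_vars \<phi>"
| "free_vars (Conj \<phi> \<psi>) = free_vars \<phi> \<union> free_vars \<psi>"
| "free_vars (Exists i \<phi>) = free_vars \<phi> - {i}"

text \<open>
  The interpretations are total HOL functions; only their values on symbols of the language and on
  tuples from the universe of the right length carry meaning.
\<close>

record ('f, 'r, 'a) fo_structure =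
  universe :: "'a set"
  fun_interp :: "'f \<Rightarrow> 'a list \<Rightarrow> 'a"
  rel_interp :: "'r \<Rightarrow> 'a list \<Rightarrow> bool"

definition tuples :: "('f, 'r, 'a) fo_structure \<Rightarrow> nat \<Rightarrow> 'a list set" where
  "tuples \<M> k = {xs. length xs = k \<and> set xs \<subseteq> universe \<M>}"

definition structure_in :: "('f, 'r) language \<Rightarrow> ('f, 'r, 'a) fo_structure \<Rightarrow> bool" where
  "structure_in L \<M> \<longleftrightarrow>
     universe \<M> \<noteq> {} \<and>
     (\<forall>f \<in> fun_syms L. \<forall>xs \<in> tuples \<M> (fun_arity L f). fun_interp \<M> f xs \<in> universe \<M>)"

primrec eval_term :: "('f, 'r, 'a) fo_structure \<Rightarrow> (nat \<Rightarrow> 'a) \<Rightarrow> 'f fo_term \<Rightarrow> 'a" where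
  "eval_term \<M> e (Var i) = e i"
| "eval_term \<M> e (Fn f ts) = fun_interp \<M> f (map (eval_term \<M> e) ts)"

primrec sat :: "('f, 'r, 'a) fo_structure \<Rightarrow> (nat \<Rightarrow> 'a) \<Rightarrow> ('f, 'r) fo_formula \<Rightarrow> bool" where
  "sat \<M> e (Eq s t) \<longleftrightarrow> eval_term \<M> e s = eval_term \<M> e t"
| "sat \<M> e (Rel R ts) \<longleftrightarrow> rel_interp \<M> R (map (eval_term \<M> e) ts)"
| "sat \<M> e (Neg \<phi>) \<longleftrightarrow> \<not> sat \<M> e \<phi>"
| "sat \<M> e (Conj \<phi> \<psi>) \<longleftrightarrow> sat \<M> e \<phi> \<and> sat \<M> e \<psi>"
| "sat \<M> e (Exists i \<phi>) \<longleftrightarrow> (\<exists>a \<in> universe \<M>. sat \<M> (e(i := a)) \<phi>)"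

definition unary_predicate_language :: "('f, 'r) language \<Rightarrow> bool" where
  "unary_predicate_language L \<longleftrightarrow> fun_syms L = {} \<and> (\<forall>R \<in> rel_syms L. rel_arity L R = 1)"


section \<open>Definable closure, automorphisms and rigidity\<close>

text \<open>
  Variable 0 is the one being defined; every other free variable of the formula is a slot for a
  parameter, which the assignment fills with an element of \<open>A\<close>.
\<close>

definition dcl :: "('f, 'r) language \<Rightarrow> ('f, 'r, 'a) fo_structure \<Rightarrow> 'a set \<Rightarrow> 'a set" where
  "dcl L \<M> A = {b \<in> universe \<M>. \<exists>\<phi> e. formula_in L \<phi> \<and> (\<forall>i \<in> free_vars \<phi> - {0}. e i \<in> A) \<and>
     {c \<in> universe \<M>. sat \<M> (e(0 := c)) \<phi>} = {b}}"

definition automorphism ::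
    "('f, 'r) language \<Rightarrow> ('f, 'r, 'a) fo_structure \<Rightarrow> ('a \<Rightarrow> 'a) \<Rightarrow> bool" where
  "automorphism L \<M> h \<longleftrightarrow>
     bij_betw h (universe \<M>) (universe \<M>) \<and>
     (\<forall>f \<in> fun_syms L. \<forall>xs \<in> tuples \<M> (fun_arity L f).
        h (fun_interp \<M> f xs) = fun_interp \<M> f (map h xs)) \<and>
     (\<forall>R \<in> rel_syms L. \<forall>xs \<in> tuples \<M> (rel_arity L R).
        rel_interp \<M> R (map h xs) \<longleftrightarrow> rel_interp \<M> R xs)"

text \<open>
  Automorphisms are HOL functions with arbitrary values outside the universe, so being the identity
  is required on the universe only.
\<close>

definition sem_rigid :: "('f, 'r) language \<Rightarrow> ('f, 'r, 'a) fo_structure \<Rightarrow> 'a set \<Rightarrow> bool" where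
  "sem_rigid L \<M> A \<longleftrightarrow>
     (\<forall>h. automorphism L \<M> h \<and> (\<forall>a \<in> A. h a = a) \<longrightarrow> (\<forall>x \<in> universe \<M>. h x = x))"

definition synt_rigid :: "('f, 'r) language \<Rightarrow> ('f, 'r, 'a) fo_structure \<Rightarrow> 'a set \<Rightarrow> bool" where
  "synt_rigid L \<M> A \<longleftrightarrow> universe \<M> = dcl L \<M> A"

definition all_sem_rigid :: "('f, 'r) language \<Rightarrow> ('f, 'r, 'a) fo_structure \<Rightarrow> nat \<Rightarrow> bool" where
  "all_sem_rigid L \<M> n \<longleftrightarrow>
     (\<forall>A. A \<subseteq> universe \<M> \<and> finite A \<and> card A = n \<longrightarrow> sem_rigid L \<M> A)"

definition all_synt_rigid :: "('f, 'r) language \<Rightarrow> ('f, 'r, 'a) fo_structure \<Rightarrow> nat \<Rightarrow> bool" where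
  "all_synt_rigid L \<M> n \<longleftrightarrow>
     (\<forall>A. A \<subseteq> universe \<M> \<and> finite A \<and> card A = n \<longrightarrow> synt_rigid L \<M> A)"

definition least_or_infinity :: "(nat \<Rightarrow> bool) \<Rightarrow> enat" where
  "least_or_infinity P = (if \<exists>n. P n then enat (LEAST n. P n) else \<infinity>)"

definition deg_sem :: "('f, 'r) language \<Rightarrow> ('f, 'r, 'a) fo_structure \<Rightarrow> enat" where
  "deg_sem L \<M> = least_or_infinity (all_sem_rigid L \<M>)"

definition deg_synt :: "('f, 'r) language \<Rightarrow> ('f, 'r, 'a) fo_structure \<Rightarrow> enat" where
  "deg_synt L \<M> = least_or_infinity (all_synt_rigid L \<M>)"

end

theory Submission
  imports Defs "HOL-Combinatorics.Transposition"
begin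

text \<open>
  In a structure with unary predicates only, all that can be said about an element is which
  predicates it satisfies, i.e. its type, together with its equality or inequality to parameters.

  On the semantic side, transposing two elements of the same type is an automorphism, so
  \<open>\<M>\<close> is semantically rigid over \<open>A\<close> exactly when no two elements outside \<open>A\<close> share a type
  (\<open>sem_rigid_iff_types_distinct\<close>).  On the syntactic side, a formula mentions a finite set \<open>F\<close> of
  predicates only, and the same transposition argument applies to the reduct to \<open>F\<close>; hence an
  element outside a finite \<open>A\<close> is definable over \<open>A\<close> exactly when some finite \<open>F\<close> separates it from
  everything else outside \<open>A\<close> (\<open>in_dcl_iff_finitely_separated\<close>).

  Both degrees now become a matter of counting. Syntactic rigidity over \<open>A\<close> always implies semantic
  rigidity over \<open>A\<close>, because automorphisms fixing \<open>A\<close> fix its definable closure.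
  If two elements share a type, every parameter set avoiding both fails to rigidify; such sets exist
  in all sizes if \<open>\<M>\<close> is infinite, and in all sizes below \<open>n\<close> if \<open>\<M>\<close> has \<open>n + 1\<close> elements, while \<open>n\<close>
  parameters leave out a single element, which they therefore define.
  If no two elements share a type, finite sets of competitors can be separated by finitely many
  predicates. So a finite \<open>\<M>\<close> is syntactically rigid; and if some \<open>b\<close> is not definable without
  parameters, then infinitely many elements agree with \<open>b\<close> on any given finite \<open>F\<close>, and
  finitely many parameters other than \<open>b\<close> cannot remove all of them
  (\<open>infinite_not_all_synt_rigid\<close>).
\<close>

section \<open>Automorphisms and definable closure\<close>

lemma dclI:
  assumes "b \<in> universe \<M>" "formula_in L \<phi>" "\<And>i. i \<in> free_vars \<phi> - {0} \<Longrightarrow> e i \<in> A"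
    and "{c \<in> universe \<M>. sat \<M> (e(0 := c)) \<phi>} = {b}"
  shows "b \<in> dcl L \<M> A"
  using assms unfolding dcl_def by blast

lemma eval_term_automorphism:
  assumes "structure_in L \<M>" "automorphism L \<M> h" "term_in L t"
    and "\<forall>i \<in> term_vars t. e i \<in> universe \<M> \<and> e' i = h (e i)"
  shows "eval_term \<M> e t \<in> universe \<M> \<and> eval_term \<M> e' t = h (eval_term \<M> e t)"
  using assms(3,4)
proof (induction t)
  case (Var i)
  then show ?case by simp
next
  case (Fn f ts)
  have IH: "eval_term \<M> e t \<in> universe \<M> \<and> eval_term \<M> e' t = h (eval_term \<M> e t)"
    if "t \<in> set ts" for t
    using Fn that by auto
  let ?xs = "map (eval_term \<M> e) ts"
  have f: "f \<in> fun_syms L" and xs: "?xs \<in> tuples \<M> (fun_arity L f)"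
    using Fn.prems IH by (auto simp: tuples_def)
  have "map (eval_term \<M> e') ts = map h ?xs"
    using IH by simp
  moreover have "fun_interp \<M> f ?xs \<in> universe \<M>"
    using assms(1) f xs by (simp add: structure_in_def)
  moreover have "h (fun_interp \<M> f ?xs) = fun_interp \<M> f (map h ?xs)"
    using assms(2) f xs unfolding automorphism_def by blast
  ultimately show ?case by (simp del: map_map)
qed

text \<open>
  Relating two assignments on the free variables only, rather than composing one assignment with
  the automorphism, spares a separate coincidence lemma: assignments may take values outside the
  universe, or values moved by the automorphism, at variables that are not free.
\<close>

lemma sat_automorphism:
  assumes "structure_in L \<M>" "automorphism L \<M> h" "formula_in L \<phi>"
    and "\<forall>i \<in> free_vars \<phi>. e i \<in> universe \<M> \<and> e' i = h (e i)"
  shows "sat \<M> e' \<phi> \<longleftrightarrow> sat \<M> e \<phi>"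
  using assms(3,4)
proof (induction \<phi> arbitrary: e e')
  case (Eq s t)
  have "inj_on h (universe \<M>)"
    using assms(2) by (simp add: automorphism_def bij_betw_def)
  then show ?case
    using Eq eval_term_automorphism[OF assms(1,2), of s e e']
      eval_term_automorphism[OF assms(1,2), of t e e']
    by (auto dest: inj_onD)
next
  case (Rel R ts)
  have ev: "eval_term \<M> e t \<in> universe \<M> \<and> eval_term \<M> e' t = h (eval_term \<M> e t)"
    if "t \<in> set ts" for t
    using Rel that by (intro eval_term_automorphism[OF assms(1,2)]) auto
  let ?xs = "map (eval_term \<M> e) ts"
  have "R \<in> rel_syms L" "?xs \<in> tuples \<M> (rel_arity L R)"
    using Rel.prems ev by (auto simp: tuples_def)
  then have "rel_interp \<M> R (map h ?xs) \<longleftrightarrow> rel_interp \<M> R ?xs"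
    using assms(2) unfolding automorphism_def by blast
  moreover have "map (eval_term \<M> e') ts = map h ?xs"
    using ev by simp
  ultimately show ?case by (simp del: map_map)
next
  case (Exists i \<phi>)
  have img: "h ` universe \<M> = universe \<M>"
    using assms(2) by (simp add: automorphism_def bij_betw_def)
  have step: "sat \<M> (e'(i := h a)) \<phi> \<longleftrightarrow> sat \<M> (e(i := a)) \<phi>" if "a \<in> universe \<M>" for a
    using Exists.prems that by (intro Exists.IH) auto
  have "(\<exists>a \<in> universe \<M>. sat \<M> (e'(i := a)) \<phi>)
      \<longleftrightarrow> (\<exists>a \<in> h ` universe \<M>. sat \<M> (e'(i := a)) \<phi>)"
    by (simp only: img)
  also have "\<dots> \<longleftrightarrow> (\<exists>a \<in> universe \<M>. sat \<M> (e(i := a)) \<phi>)"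
    using step by auto
  finally show ?case by simp
next
  case (Neg \<phi>)
  have "sat \<M> e' \<phi> \<longleftrightarrow> sat \<M> e \<phi>"
    using Neg.prems by (intro Neg.IH) auto
  then show ?case by simp
next
  case (Conj \<phi> \<psi>)
  have "sat \<M> e' \<phi> \<longleftrightarrow> sat \<M> e \<phi>" "sat \<M> e' \<psi> \<longleftrightarrow> sat \<M> e \<psi>"
    using Conj.prems by (auto intro!: Conj.IH)
  then show ?case by simp
qed

lemma automorphism_fixes_dcl:
  assumes "structure_in L \<M>" "automorphism L \<M> h" "A \<subseteq> universe \<M>" "\<forall>a \<in> A. h a = a"
    and "b \<in> dcl L \<M> A"
  shows "h b = b"
proof -
  obtain \<phi> e where \<phi>: "formula_in L \<phi>" "\<forall>i \<in> free_vars \<phi> - {0}. e i \<in> A"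
    and b: "{c \<in> universe \<M>. sat \<M> (e(0 := c)) \<phi>} = {b}"
    using assms(5) by (auto simp: dcl_def)
  then have "b \<in> universe \<M>" by blast
  then have "sat \<M> (e(0 := h b)) \<phi> \<longleftrightarrow> sat \<M> (e(0 := b)) \<phi>"
    using \<phi> assms(3,4) by (intro sat_automorphism[OF assms(1,2)]) auto
  moreover have "h b \<in> universe \<M>"
    using assms(2) \<open>b \<in> universe \<M>\<close> by (auto simp: automorphism_def bij_betw_def)
  ultimately show ?thesis
    using b by blast
qed

lemma synt_rigid_iff_subset_dcl: "synt_rigid L \<M> A \<longleftrightarrow> universe \<M> \<subseteq> dcl L \<M> A"
  by (auto simp: synt_rigid_def dcl_def)

lemma synt_rigid_imp_sem_rigid:
  assumes "structure_in L \<M>" "A \<subseteq> universe \<M>" "synt_rigid L \<M> A"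
  shows "sem_rigid L \<M> A"
  unfolding sem_rigid_def
proof (intro allI impI ballI, elim conjE)
  fix h x assume "automorphism L \<M> h" "\<forall>a \<in> A. h a = a" "x \<in> universe \<M>"
  moreover from this have "x \<in> dcl L \<M> A"
    using assms(3) by (simp add: synt_rigid_def)
  ultimately show "h x = x"
    using automorphism_fixes_dcl[OF assms(1) _ assms(2)] by blast
qed

section \<open>Finite reducts\<close>

lemma finite_symbols: "finite (set2_fo_formula \<phi>)"
  by (induction \<phi>) auto

lemma symbols_subset_rel_syms: "formula_in L \<phi> \<Longrightarrow> set2_fo_formula \<phi> \<subseteq> rel_syms L"
  by (induction \<phi>) auto

lemma term_in_reduct: "term_in (L\<lparr>rel_syms := F\<rparr>) t \<longleftrightarrow> term_in L t"
  by (induction t) auto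

lemma formula_in_reduct:
  "formula_in L \<phi> \<Longrightarrow> set2_fo_formula \<phi> \<subseteq> F \<Longrightarrow> formula_in (L\<lparr>rel_syms := F\<rparr>) \<phi>"
  by (induction \<phi>) (auto simp: term_in_reduct)

lemma dcl_in_finite_reduct:
  assumes "b \<in> dcl L \<M> A"
  obtains F where "finite F" "F \<subseteq> rel_syms L" "b \<in> dcl (L\<lparr>rel_syms := F\<rparr>) \<M> A"
proof -
  obtain \<phi> e where "formula_in L \<phi>" "\<forall>i \<in> free_vars \<phi> - {0}. e i \<in> A" "b \<in> universe \<M>"
    "{c \<in> universe \<M>. sat \<M> (e(0 := c)) \<phi>} = {b}"
    using assms by (auto simp: dcl_def)
  then have "b \<in> dcl (L\<lparr>rel_syms := set2_fo_formula \<phi>\<rparr>) \<M> A"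
    by (intro dclI[where \<phi> = \<phi> and e = e]) (auto intro: formula_in_reduct)
  with finite_symbols symbols_subset_rel_syms[OF \<open>formula_in L \<phi>\<close>] show thesis
    by (rule that)
qed

section \<open>Types of elements in unary languages\<close>

definition agree_on :: "'r set \<Rightarrow> ('f, 'r, 'a) fo_structure \<Rightarrow> 'a \<Rightarrow> 'a \<Rightarrow> bool" where
  "agree_on F \<M> a b \<longleftrightarrow> (\<forall>R \<in> F. rel_interp \<M> R [a] \<longleftrightarrow> rel_interp \<M> R [b])"

lemma automorphism_unary_iff:
  assumes "unary_predicate_language L"
  shows "automorphism L \<M> h \<longleftrightarrow> bij_betw h (universe \<M>) (universe \<M>) \<and>
    (\<forall>a \<in> universe \<M>. agree_on (rel_syms L) \<M> (h a) a)"
proof -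
  have "tuples \<M> 1 = (\<lambda>a. [a]) ` universe \<M>"
    by (auto simp: tuples_def length_Suc_conv)
  then show ?thesis
    using assms by (auto simp: automorphism_def unary_predicate_language_def agree_on_def)
qed

lemma automorphism_transpose:
  assumes "unary_predicate_language L" "a \<in> universe \<M>" "b \<in> universe \<M>"
    and "agree_on (rel_syms L) \<M> a b"
  shows "automorphism L \<M> (transpose a b)"
proof -
  have "bij_betw (transpose a b) (universe \<M>) (universe \<M>)"
    using assms(2,3) by (simp add: bij_betw_transpose_iff)
  then show ?thesis
    using assms by (auto simp: automorphism_unary_iff agree_on_def transpose_def)
qed

lemma sem_rigid_iff_types_distinct:
  assumes "unary_predicate_language L" "A \<subseteq> universe \<M>"
  shows "sem_rigid L \<M> A \<longleftrightarrow>
    (\<forall>a \<in> universe \<M> - A. \<forall>b \<in> universe \<M> - A. agree_on (rel_syms L) \<M> a b \<longrightarrow> a = b)"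
proof
  assume rigid: "sem_rigid L \<M> A"
  show "\<forall>a \<in> universe \<M> - A. \<forall>b \<in> universe \<M> - A. agree_on (rel_syms L) \<M> a b \<longrightarrow> a = b"
  proof (intro ballI impI)
    fix a b assume ab: "a \<in> universe \<M> - A" "b \<in> universe \<M> - A" "agree_on (rel_syms L) \<M> a b"
    then have "automorphism L \<M> (transpose a b)"
      by (intro automorphism_transpose[OF assms(1)]) auto
    moreover have "\<forall>x \<in> A. transpose a b x = x"
      using ab by (auto simp: transpose_def)
    ultimately have "transpose a b a = a"
      using rigid ab unfolding sem_rigid_def by blast
    then show "a = b" by simp
  qed
next
  assume distinct:
    "\<forall>a \<in> universe \<M> - A. \<forall>b \<in> universe \<M> - A. agree_on (rel_syms L) \<M> a b \<longrightarrow> a = b"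
  show "sem_rigid L \<M> A"
    unfolding sem_rigid_def
  proof (intro allI impI ballI, elim conjE)
    fix h x assume h: "automorphism L \<M> h" "\<forall>a \<in> A. h a = a" and x: "x \<in> universe \<M>"
    have bij: "bij_betw h (universe \<M>) (universe \<M>)" and "agree_on (rel_syms L) \<M> (h x) x"
      using h(1) x by (auto simp: automorphism_unary_iff[OF assms(1)])
    moreover have "h x \<in> universe \<M>"
      using bij x by (auto simp: bij_betw_def)
    \<comment> \<open>An element outside \<open>A\<close> cannot be moved into \<open>A\<close>, whose elements are their own images.\<close>
    moreover have "h x \<notin> A" if "x \<notin> A"
      using that h(2) x assms(2) bij_betw_imp_inj_on[OF bij] by (metis inj_onD subsetD)
    ultimately show "h x = x"
      using distinct h(2) x by (cases "x \<in> A") auto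
  qed
qed

section \<open>Definability in unary languages\<close>

lemma formula_defining_agreement:
  fixes \<M> :: "('f, 'r, 'a) fo_structure"
  assumes "unary_predicate_language L" "finite F" "F \<subseteq> rel_syms L"
  shows "\<exists>\<phi>. formula_in L \<phi> \<and> free_vars \<phi> \<subseteq> {0} \<and>
    (\<forall>e. sat \<M> e \<phi> \<longleftrightarrow> agree_on F \<M> (e 0) b)"
  using assms(2,3)
proof (induction F)
  case empty
  show ?case
    by (rule exI[of _ "Eq (Var 0) (Var 0)"]) (simp add: agree_on_def)
next
  case (insert R F)
  then obtain \<phi> where \<phi>: "formula_in L \<phi>" "free_vars \<phi> \<subseteq> {0}"
    "\<forall>e. sat \<M> e \<phi> \<longleftrightarrow> agree_on F \<M> (e 0) b"
    by auto
  define \<rho> :: "('f, 'r) fo_formula"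
    where "\<rho> = (if rel_interp \<M> R [b] then Rel R [Var 0] else Neg (Rel R [Var 0]))"
  have "formula_in L \<rho>" "free_vars \<rho> \<subseteq> {0}"
    "\<forall>e. sat \<M> e \<rho> \<longleftrightarrow> (rel_interp \<M> R [e 0] \<longleftrightarrow> rel_interp \<M> R [b])"
    using assms(1) insert.prems by (auto simp: \<rho>_def unary_predicate_language_def)
  with \<phi> show ?case
    by (intro exI[of _ "Conj \<phi> \<rho>"]) (auto simp: agree_on_def)
qed

lemma formula_defining_complement:
  "\<exists>\<phi>. formula_in L \<phi> \<and> free_vars \<phi> \<subseteq> {0..n} \<and>
    (\<forall>c. sat \<M> (e(0 := c)) \<phi> \<longleftrightarrow> c \<notin> e ` {1..n})"
proof (induction n)
  case 0
  show ?case
    by (rule exI[of _ "Eq (Var 0) (Var 0)"]) simp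
next
  case (Suc n)
  then obtain \<phi> where \<phi>: "formula_in L \<phi>" "free_vars \<phi> \<subseteq> {0..n}"
    "\<forall>c. sat \<M> (e(0 := c)) \<phi> \<longleftrightarrow> c \<notin> e ` {1..n}"
    by blast
  let ?\<psi> = "Conj \<phi> (Neg (Eq (Var 0) (Var (Suc n))))"
  have "e ` {1..Suc n} = insert (e (Suc n)) (e ` {1..n})"
    by (auto simp: atLeastAtMostSuc_conv)
  then have "sat \<M> (e(0 := c)) ?\<psi> \<longleftrightarrow> c \<notin> e ` {1..Suc n}" for c
    using \<phi>(3)[rule_format, of c]
    by (simp del: fun_upd_apply add: fun_upd_same fun_upd_other) blast
  moreover have "formula_in L ?\<psi>" "free_vars ?\<psi> \<subseteq> {0..Suc n}"
    using \<phi>(1,2) by auto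
  ultimately show ?case by blast
qed

text \<open>
  If \<open>c\<close> were another element outside \<open>A\<close> agreeing with \<open>b\<close> on the predicates of a formula that
  defines \<open>b\<close>, then transposing \<open>b\<close> and \<open>c\<close> would be an automorphism of the corresponding reduct,
  fixing the parameters and so fixing \<open>b\<close>. Conversely, inequality to each of the finitely many
  parameters and membership or non-membership in each predicate of \<open>F\<close> can be written down.
\<close>

lemma in_dcl_iff_finitely_separated:
  assumes "unary_predicate_language L" "structure_in L \<M>" "A \<subseteq> universe \<M>" "finite A"
    and b: "b \<in> universe \<M>"
  shows "b \<in> dcl L \<M> A \<longleftrightarrow> b \<in> A \<or>
    (\<exists>F. finite F \<and> F \<subseteq> rel_syms L \<and> (\<forall>c \<in> universe \<M> - A. agree_on F \<M> c b \<longrightarrow> c = b))"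
    (is "_ \<longleftrightarrow> _ \<or> ?separated")
proof
  assume "b \<in> dcl L \<M> A"
  then obtain F where F: "finite F" "F \<subseteq> rel_syms L" and dcl: "b \<in> dcl (L\<lparr>rel_syms := F\<rparr>) \<M> A"
    by (rule dcl_in_finite_reduct)
  have unary: "unary_predicate_language (L\<lparr>rel_syms := F\<rparr>)"
    using assms(1) F(2) by (auto simp: unary_predicate_language_def)
  have struct: "structure_in (L\<lparr>rel_syms := F\<rparr>) \<M>"
    using assms(2) by (simp add: structure_in_def)
  have "c = b" if "b \<notin> A" "c \<in> universe \<M> - A" "agree_on F \<M> c b" for c
  proof -
    have "automorphism (L\<lparr>rel_syms := F\<rparr>) \<M> (transpose c b)"
      using that b by (intro automorphism_transpose[OF unary]) auto
    moreover have "\<forall>a \<in> A. transpose c b a = a"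
      using that by (auto simp: transpose_def)
    ultimately have "transpose c b b = b"
      using automorphism_fixes_dcl[OF struct _ assms(3) _ dcl] by blast
    then show ?thesis by simp
  qed
  then show "b \<in> A \<or> ?separated"
    using F by blast
next
  assume "b \<in> A \<or> ?separated"
  then consider "b \<in> A" | "b \<notin> A" ?separated by blast
  then show "b \<in> dcl L \<M> A"
  proof cases
    case 1
    then show ?thesis
      using b by (intro dclI[where \<phi> = "Eq (Var 0) (Var 1)" and e = "\<lambda>_. b"]) auto
  next
    case 2
    then obtain F where F: "finite F" "F \<subseteq> rel_syms L"
      and sep: "\<forall>c \<in> universe \<M> - A. agree_on F \<M> c b \<longrightarrow> c = b"
      by blast
    \<comment> \<open>The enumeration starts at 1 because variable 0 is the one being defined.\<close>
    obtain e where "bij_betw e {1..card A} A"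
      using ex_bij_betw_nat_finite_1[OF \<open>finite A\<close>] by blast
    then have e: "e ` {1..card A} = A"
      by (simp add: bij_betw_def)
    obtain \<phi> where \<phi>: "formula_in L \<phi>" "free_vars \<phi> \<subseteq> {0}"
      "\<forall>e. sat \<M> e \<phi> \<longleftrightarrow> agree_on F \<M> (e 0) b"
      using formula_defining_agreement[OF assms(1) F, of \<M> b] by blast
    obtain \<psi> where \<psi>: "formula_in L \<psi>" "free_vars \<psi> \<subseteq> {0..card A}"
      "\<forall>c. sat \<M> (e(0 := c)) \<psi> \<longleftrightarrow> c \<notin> A"
      using formula_defining_complement[of L "card A" \<M> e] unfolding e by blast
    have "e i \<in> A" if "i \<in> free_vars (Conj \<phi> \<psi>) - {0}" for i
    proof -
      have "i \<in> {1..card A}"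
        using that \<phi>(2) \<psi>(2) by auto
      then show ?thesis
        using e by blast
    qed
    moreover have "{c \<in> universe \<M>. sat \<M> (e(0 := c)) (Conj \<phi> \<psi>)} = {b}"
      using \<phi>(3) \<psi>(3) sep b 2(1) by (auto simp: agree_on_def)
    moreover have "formula_in L (Conj \<phi> \<psi>)"
      using \<phi>(1) \<psi>(1) by simp
    ultimately show ?thesis
      using b by (intro dclI[where \<phi> = "Conj \<phi> \<psi>" and e = e])
  qed
qed

text \<open>
  One separating predicate is chosen for each of the finitely many elements other than \<open>b\<close>. This
  turns distinctness of types, a condition on all predicates, into one that a formula can express.
\<close>

lemma finite_separating_predicates:
  assumes "finite C" "\<forall>c \<in> C. agree_on S \<M> c b \<longrightarrow> c = b"
  obtains F where "finite F" "F \<subseteq> S" "\<forall>c \<in> C. agree_on F \<M> c b \<longrightarrow> c = b"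
proof -
  have "\<forall>c \<in> C. \<exists>R. c \<noteq> b \<longrightarrow> R \<in> S \<and> rel_interp \<M> R [c] \<noteq> rel_interp \<M> R [b]"
    using assms(2) by (auto simp: agree_on_def)
  then obtain R where R:
    "\<And>c. c \<in> C \<Longrightarrow> c \<noteq> b \<Longrightarrow> R c \<in> S \<and> rel_interp \<M> (R c) [c] \<noteq> rel_interp \<M> (R c) [b]"
    by metis
  show thesis
  proof
    show "finite (R ` (C - {b}))" using assms(1) by simp
    show "R ` (C - {b}) \<subseteq> S" using R by auto
    show "\<forall>c \<in> C. agree_on (R ` (C - {b})) \<M> c b \<longrightarrow> c = b"
      using R by (auto simp: agree_on_def)
  qed
qed

section \<open>Degrees of rigidity\<close>

lemma finite_sem_rigid_imp_synt_rigid: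
  assumes "unary_predicate_language L" "structure_in L \<M>" "A \<subseteq> universe \<M>"
    and "finite (universe \<M>)" "sem_rigid L \<M> A"
  shows "synt_rigid L \<M> A"
proof -
  have fin: "finite A" "finite (universe \<M> - A)"
    using assms(3,4) by (auto intro: finite_subset)
  have "b \<in> dcl L \<M> A" if b: "b \<in> universe \<M>" for b
  proof (cases "b \<in> A")
    case True
    then show ?thesis
      by (simp add: in_dcl_iff_finitely_separated[OF assms(1-3) fin(1) b])
  next
    case False
    then have "\<forall>c \<in> universe \<M> - A. agree_on (rel_syms L) \<M> c b \<longrightarrow> c = b"
      using assms(1,3,5) b by (simp add: sem_rigid_iff_types_distinct)
    with fin(2) obtain F where "finite F" "F \<subseteq> rel_syms L"
      "\<forall>c \<in> universe \<M> - A. agree_on F \<M> c b \<longrightarrow> c = b"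
      by (rule finite_separating_predicates)
    then show ?thesis
      using in_dcl_iff_finitely_separated[OF assms(1-3) fin(1) b] by blast
  qed
  then show ?thesis
    by (auto simp: synt_rigid_iff_subset_dcl)
qed

lemma all_synt_rigid_imp_all_sem_rigid:
  assumes "structure_in L \<M>" "all_synt_rigid L \<M> n"
  shows "all_sem_rigid L \<M> n"
  using assms(2) synt_rigid_imp_sem_rigid[OF assms(1)]
  unfolding all_sem_rigid_def all_synt_rigid_def by blast

text \<open>
  Two elements of the same type can be transposed over any parameter set that avoids both; room for
  \<open>n\<close> further elements is what the existence of such a set requires.
\<close>

lemma not_all_sem_rigid:
  assumes "unary_predicate_language L" "\<not> sem_rigid L \<M> {}"
    and room: "infinite (universe \<M>) \<or> n + 2 \<le> card (universe \<M>)"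
  shows "\<not> all_sem_rigid L \<M> n"
proof -
  obtain a b where ab: "a \<in> universe \<M>" "b \<in> universe \<M>" "a \<noteq> b" "agree_on (rel_syms L) \<M> a b"
    using assms(1,2) by (auto simp: sem_rigid_iff_types_distinct)
  have "\<exists>A. A \<subseteq> universe \<M> - {a, b} \<and> finite A \<and> card A = n"
  proof (cases "finite (universe \<M>)")
    case True
    then have "n \<le> card (universe \<M> - {a, b})"
      using room ab by (simp add: card_Diff_subset)
    then obtain A where "A \<subseteq> universe \<M> - {a, b}" "card A = n" "finite A"
      by (rule obtain_subset_with_card_n)
    then show ?thesis by blast
  next
    case False
    then show ?thesis
      using infinite_arbitrarily_large[of "universe \<M> - {a, b}" n] by auto
  qed
  then obtain A where A: "A \<subseteq> universe \<M> - {a, b}" "finite A" "card A = n"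
    by blast
  then have "\<not> sem_rigid L \<M> A"
    using ab assms(1) by (subst sem_rigid_iff_types_distinct) auto
  with A show ?thesis
    by (auto simp: all_sem_rigid_def)
qed

lemma all_synt_rigid_all_but_one:
  assumes "unary_predicate_language L" "structure_in L \<M>"
    and "finite (universe \<M>)" "card (universe \<M>) = n + 1"
  shows "all_synt_rigid L \<M> n"
  unfolding all_synt_rigid_def
proof (intro allI impI, elim conjE)
  fix A assume A: "A \<subseteq> universe \<M>" "finite A" "card A = n"
  then have "card (universe \<M> - A) = 1"
    using assms by (simp add: card_Diff_subset)
  then obtain x where x: "universe \<M> - A = {x}"
    by (auto simp: card_1_singleton_iff)
  then have "sem_rigid L \<M> A"
    using assms(1) A(1) by (simp add: sem_rigid_iff_types_distinct)
  then show "synt_rigid L \<M> A"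
    by (rule finite_sem_rigid_imp_synt_rigid[OF assms(1,2) A(1) assms(3)])
qed

text \<open>
  Let \<open>b\<close> be an element that is not definable without parameters. If only finitely many elements
  agreed with \<open>b\<close> on some finite \<open>F\<close>, semantic rigidity would provide finitely many further
  predicates separating them from \<open>b\<close>, and \<open>b\<close> would be definable after all. Infinitely many
  competitors survive any finite parameter set, so no finite set of parameters other than \<open>b\<close> helps
  to define \<open>b\<close>.
\<close>

lemma infinite_not_all_synt_rigid:
  assumes "unary_predicate_language L" "structure_in L \<M>" "infinite (universe \<M>)"
    and "sem_rigid L \<M> {}" "\<not> synt_rigid L \<M> {}"
  shows "\<not> all_synt_rigid L \<M> n"
proof -
  obtain b where b: "b \<in> universe \<M>" "b \<notin> dcl L \<M> {}"
    using assms(5) by (auto simp: synt_rigid_iff_subset_dcl)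
  have inf: "infinite {c \<in> universe \<M>. agree_on F \<M> c b}" if F: "finite F" "F \<subseteq> rel_syms L" for F
  proof
    assume "finite {c \<in> universe \<M>. agree_on F \<M> c b}"
    moreover have
      "\<forall>c \<in> {c \<in> universe \<M>. agree_on F \<M> c b}. agree_on (rel_syms L) \<M> c b \<longrightarrow> c = b"
      using assms(1,4) b(1) by (simp add: sem_rigid_iff_types_distinct)
    ultimately obtain G where G: "finite G" "G \<subseteq> rel_syms L"
      "\<forall>c \<in> {c \<in> universe \<M>. agree_on F \<M> c b}. agree_on G \<M> c b \<longrightarrow> c = b"
      by (rule finite_separating_predicates)
    then have "\<forall>c \<in> universe \<M>. agree_on (F \<union> G) \<M> c b \<longrightarrow> c = b"
      by (auto simp: agree_on_def)
    moreover have "finite (F \<union> G)" "F \<union> G \<subseteq> rel_syms L"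
      using F G by auto
    ultimately show False
      using b in_dcl_iff_finitely_separated[OF assms(1,2), of "{}" b] by auto
  qed
  obtain A where A: "A \<subseteq> universe \<M> - {b}" "finite A" "card A = n"
    using infinite_arbitrarily_large[of "universe \<M> - {b}" n] assms(3) by auto
  have "b \<notin> dcl L \<M> A"
  proof
    assume "b \<in> dcl L \<M> A"
    moreover have "A \<subseteq> universe \<M>" "b \<notin> A"
      using A(1) by auto
    ultimately obtain F where F: "finite F" "F \<subseteq> rel_syms L"
      "\<forall>c \<in> universe \<M> - A. agree_on F \<M> c b \<longrightarrow> c = b"
      using in_dcl_iff_finitely_separated[OF assms(1,2) _ A(2) b(1)] by blast
    then have "{c \<in> universe \<M>. agree_on F \<M> c b} \<subseteq> insert b A"
      by auto
    then show False
      using inf[OF F(1,2)] A(2) finite_subset by blast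
  qed
  then have "\<not> synt_rigid L \<M> A"
    using b(1) by (auto simp: synt_rigid_def)
  with A show ?thesis
    by (auto simp: all_synt_rigid_def)
qed

lemma least_or_infinity_eq_enat:
  assumes "P n" "\<And>k. k < n \<Longrightarrow> \<not> P k"
  shows "least_or_infinity P = enat n"
proof -
  have "(LEAST k. P k) = n"
    using assms by (intro Least_equality) (auto simp: not_less[symmetric])
  then show ?thesis
    using assms(1) by (auto simp: least_or_infinity_def)
qed

lemma least_or_infinity_eq_infinity: "(\<And>n. \<not> P n) \<Longrightarrow> least_or_infinity P = \<infinity>"
  by (simp add: least_or_infinity_def)

lemma deg_sem_eq_0: "sem_rigid L \<M> {} \<Longrightarrow> deg_sem L \<M> = 0"
  unfolding deg_sem_def zero_enat_def
  by (rule least_or_infinity_eq_enat) (auto simp: all_sem_rigid_def)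

lemma deg_synt_eq_0: "synt_rigid L \<M> {} \<Longrightarrow> deg_synt L \<M> = 0"
  unfolding deg_synt_def zero_enat_def
  by (rule least_or_infinity_eq_enat) (auto simp: all_synt_rigid_def)

theorem proposition2p7:
  fixes L :: "('f, 'r) language" and \<M> :: "('f, 'r, 'a) fo_structure"
  assumes "unary_predicate_language L"
    and "structure_in L \<M>"
  shows
    "(sem_rigid L \<M> {} \<and> synt_rigid L \<M> {} \<and>
        (deg_sem L \<M>, deg_synt L \<M>) = (0, 0))
   \<or> (\<exists>n::nat. finite (universe \<M>) \<and> card (universe \<M>) = n + 1 \<and>
        \<not> sem_rigid L \<M> {} \<and> \<not> synt_rigid L \<M> {} \<and>
        (deg_sem L \<M>, deg_synt L \<M>) = (enat n, enat n))
   \<or> (infinite (universe \<M>) \<and> sem_rigid L \<M> {} \<and> \<not> synt_rigid L \<M> {} \<and>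
        (deg_sem L \<M>, deg_synt L \<M>) = (0, \<infinity>))
   \<or> (infinite (universe \<M>) \<and> \<not> sem_rigid L \<M> {} \<and> \<not> synt_rigid L \<M> {} \<and>
        (deg_sem L \<M>, deg_synt L \<M>) = (\<infinity>, \<infinity>))"
proof -
  consider
      (both) "synt_rigid L \<M> {}" "sem_rigid L \<M> {}"
    | (sem) "sem_rigid L \<M> {}" "\<not> synt_rigid L \<M> {}" "infinite (universe \<M>)"
    | (fin) "\<not> sem_rigid L \<M> {}" "\<not> synt_rigid L \<M> {}" "finite (universe \<M>)"
    | (inf) "\<not> sem_rigid L \<M> {}" "\<not> synt_rigid L \<M> {}" "infinite (universe \<M>)"
    using synt_rigid_imp_sem_rigid[OF assms(2), of "{}"]
      finite_sem_rigid_imp_synt_rigid[OF assms, of "{}"]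
    by blast
  then show ?thesis
  proof cases
    case both
    then show ?thesis
      by (simp add: deg_sem_eq_0 deg_synt_eq_0)
  next
    case sem
    then have "deg_synt L \<M> = \<infinity>"
      using infinite_not_all_synt_rigid[OF assms]
      by (auto simp: deg_synt_def intro: least_or_infinity_eq_infinity)
    with sem show ?thesis
      by (simp add: deg_sem_eq_0)
  next
    case fin
    have "card (universe \<M>) \<noteq> 0"
      using fin(3) assms(2) by (simp add: structure_in_def)
    then obtain n where n: "card (universe \<M>) = n + 1"
      using not0_implies_Suc by auto
    have synt: "all_synt_rigid L \<M> n"
      using all_synt_rigid_all_but_one[OF assms fin(3) n] .
    have not_sem: "\<not> all_sem_rigid L \<M> k" if "k < n" for k
      using not_all_sem_rigid[OF assms(1) fin(1)] n that by simp
    have "deg_sem L \<M> = enat n"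
      unfolding deg_sem_def
      using all_synt_rigid_imp_all_sem_rigid[OF assms(2) synt] not_sem
      by (rule least_or_infinity_eq_enat)
    moreover have "deg_synt L \<M> = enat n"
      unfolding deg_synt_def
      using synt not_sem all_synt_rigid_imp_all_sem_rigid[OF assms(2)]
      by (blast intro: least_or_infinity_eq_enat)
    ultimately show ?thesis
      using fin n by blast
  next
    case inf
    have not_sem: "\<not> all_sem_rigid L \<M> n" for n
      using not_all_sem_rigid[OF assms(1) inf(1)] inf(3) by blast
    have "deg_sem L \<M> = \<infinity>"
      unfolding deg_sem_def using not_sem by (rule least_or_infinity_eq_infinity)
    moreover have "deg_synt L \<M> = \<infinity>"
      unfolding deg_synt_def
      using not_sem all_synt_rigid_imp_all_sem_rigid[OF assms(2)]
      by (blast intro: least_or_infinity_eq_infinity)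
    ultimately show ?thesis
      using inf by simp
  qed
qed

end
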